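(* Let $T$ be a non-degenerate simplex in $\mathbb{R}^d$ with vertices ${\bf v}_0,\ldots,{\bf v}_d$ and circumcenter ${\bf c}$, and let $\Sigma=\{0,1,\ldots,d\}$. For every non-empty subset $I\subset\Sigma$, the sets $G_I$ and $F_I$ are mutually orthogonal, the set $\varphi^{-1}(G_I)=\{{\bf x}\in\mathbb{R}^d:\varphi({\bf x})\in G_I\}$ is a convex set with non-empty interior, and $$\varphi^{-1}(G_I)=G_I\oplus\tfrac12(F_I-{\bf c})=\tfrac12(D_I\oplus F_I).$$
   Context: A simplex with $d+1$ vertices in $\mathbb{R}^d$ is non-degenerate if it is not contained in any $(d-1)$-dimensional hyperplane. The circumcenter ${\bf c}$ is the point equidistant from ${\bf v}_0,\ldots,{\bf v}_d$. Let ${\bf u}_i=\frac12({\bf c}+{\bf v}_i)$, $i\in\Sigma$, and let $U=\frac12({\bf c}+T)$ be the simplex with vertices ${\bf u}_0,\ldots,{\bf u}_d$. The mapping $\varphi:\mathbb{R}^d\to U$ sends ${\bf x}$ to the unique point of $U$ closest to ${\bf x}$ in the Euclidean norm $|\cdot|$. For non-empty $I\subset\Sigma$: - $G_I:=\{{\bf x}\in U: b_i({\bf x})>0\text{ for }i\in I,\ b_i({\bf x})=0\text{ for }i\notin I\}$, where $b_i({\bf x})$ are the barycentric coordinates of ${\bf x}$ with respect to $U$; - $D_I:=\{{\bf x}\in T:\beta_i({\bf x})>0\text{ for }i\in I,\ \beta_i({\bf x})=0\text{ for }i\notin I\}$, where $\beta_i({\bf x})$ are the barycentric coordinates of ${\bf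 x}$ with respect to $T$; - $F_I:=\bigcap_{i\in I}W_i$, where $W_i:=\{{\bf x}\in\mathbb{R}^d:|{\bf x}-{\bf v}_i|\le|{\bf x}-{\bf v}_j|,\ j\in\Sigma\setminus\{i\}\}$ is the Voronoi cell of ${\bf v}_i$ with respect to $\{{\bf v}_0,\ldots,{\bf v}_d\}$. Two non-empty sets $A,B\subset\mathbb{R}^d$ are mutually orthogonal if $({\bf a}_1-{\bf a}_2)\cdot({\bf b}_1-{\bf b}_2)=0$ for all ${\bf a}_1,{\bf a}_2\in A$ and ${\bf b}_1,{\bf b}_2\in B$; for such sets $A\oplus B:=\{{\bf a}+{\bf b}:{\bf a}\in A,{\bf b}\in B\}$. Also $\alpha A:=\{\alpha{\bf a}:{\bf a}\in A\}$ for $\alpha>0$, and $A-{\bf c}:=\{{\bf a}-{\bf c}:{\bf a}\in A\}$. *)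

theory Defs
  imports "HOL-Analysis.Analysis"
begin

text \<open>The space $R^d$ is a type \<open>'a\<close> of class \<open>euclidean_space\<close> with \<open>d = DIM('a)\<close>.  A simplex is
  given by its vertices \<open>v 0, ..., v d\<close>; values of \<open>v\<close> outside \<open>{0..d}\<close> are irrelevant.\<close>

definition simplex_of :: "(nat \<Rightarrow> 'a::euclidean_space) \<Rightarrow> 'a set" where
  "simplex_of v = convex hull (v ` {0..DIM('a)})"

definition nondegenerate :: "(nat \<Rightarrow> 'a::euclidean_space) \<Rightarrow> bool" where
  "nondegenerate v \<longleftrightarrow>
     \<not> (\<exists>H. affine H \<and> aff_dim H = int DIM('a) - 1 \<and> simplex_of v \<subseteq> H)"

definition circumcenter :: "(nat \<Rightarrow> 'a::euclidean_space) \<Rightarrow> 'a" where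
  "circumcenter v = (THE c. \<forall>i\<in>{0..DIM('a)}. \<forall>j\<in>{0..DIM('a)}. dist c (v i) = dist c (v j))"

text \<open>The requirement \<open>b i = 0\<close> for \<open>i > d\<close> only makes the coordinate function unique as a
  function on all of \<open>nat\<close>.\<close>

definition bary :: "(nat \<Rightarrow> 'a::euclidean_space) \<Rightarrow> 'a \<Rightarrow> nat \<Rightarrow> real" where
  "bary v x = (THE b. (\<forall>i. i \<notin> {0..DIM('a)} \<longrightarrow> b i = 0) \<and>
     (\<Sum>i\<in>{0..DIM('a)}. b i) = 1 \<and> x = (\<Sum>i\<in>{0..DIM('a)}. b i *\<^sub>R v i))"

text \<open>For the vertices of \<open>T\<close> this is \<open>D_I\<close>, for those of \<open>U\<close> it is \<open>G_I\<close>.\<close>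

definition open_face :: "(nat \<Rightarrow> 'a::euclidean_space) \<Rightarrow> nat set \<Rightarrow> 'a set" where
  "open_face v I = {x \<in> simplex_of v.
     (\<forall>i\<in>I. bary v x i > 0) \<and> (\<forall>i\<in>{0..DIM('a)} - I. bary v x i = 0)}"

definition voronoi_cell :: "(nat \<Rightarrow> 'a::euclidean_space) \<Rightarrow> nat \<Rightarrow> 'a set" where
  "voronoi_cell v i = {x. \<forall>j\<in>{0..DIM('a)} - {i}. norm (x - v i) \<le> norm (x - v j)}"

definition voronoi_face :: "(nat \<Rightarrow> 'a::euclidean_space) \<Rightarrow> nat set \<Rightarrow> 'a set" where
  "voronoi_face v I = (\<Inter>i\<in>I. voronoi_cell v i)"

definition half_vertex :: "(nat \<Rightarrow> 'a::euclidean_space) \<Rightarrow> nat \<Rightarrow> 'a" where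
  "half_vertex v i = (1/2) *\<^sub>R (circumcenter v + v i)"

lemma simplex_of_half_vertex:
  "simplex_of (half_vertex v) = (\<lambda>x. (1/2) *\<^sub>R (circumcenter v + x)) ` simplex_of v"
proof -
  have "(\<lambda>x. (1/2) *\<^sub>R (circumcenter v + x)) =
        (\<lambda>x. (1/2) *\<^sub>R circumcenter v + (1/2) *\<^sub>R x)"
    by (simp add: scaleR_add_right)
  moreover have "half_vertex v ` A = (\<lambda>x. (1/2) *\<^sub>R (circumcenter v + x)) ` v ` A" for A
    by (simp add: half_vertex_def image_image)
  ultimately show ?thesis
    unfolding simplex_of_def by (simp only: convex_hull_affinity)
qed

definition nearest_point :: "(nat \<Rightarrow> 'a::euclidean_space) \<Rightarrow> 'a \<Rightarrow> 'a" where
  "nearest_point v = closest_point (simplex_of (half_vertex v))"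

definition mutually_orthogonal :: "'a::real_inner set \<Rightarrow> 'a set \<Rightarrow> bool" where
  "mutually_orthogonal A B \<longleftrightarrow> A \<noteq> {} \<and> B \<noteq> {} \<and>
     (\<forall>a1\<in>A. \<forall>a2\<in>A. \<forall>b1\<in>B. \<forall>b2\<in>B. (a1 - a2) \<bullet> (b1 - b2) = 0)"

text \<open>The orthogonal sum is only meaningful for mutually orthogonal sets; every use of it is to be
  accompanied by an assertion of \<open>mutually_orthogonal\<close>.\<close>

definition orth_sum :: "'a::real_inner set \<Rightarrow> 'a set \<Rightarrow> 'a set" where
  "orth_sum A B = {a + b | a b. a \<in> A \<and> b \<in> B}"

definition scale_set :: "real \<Rightarrow> 'a::real_vector set \<Rightarrow> 'a set" where
  "scale_set r A = {r *\<^sub>R a | a. a \<in> A}"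

definition shift_set :: "'a::real_vector set \<Rightarrow> 'a \<Rightarrow> 'a set" where
  "shift_set A c = {a - c | a. a \<in> A}"

end

theory Submission
  imports Defs
begin

text \<open>Since all vertices are equidistant from \<open>c\<close>, the condition \<open>|x - v i| \<le> |x - v j|\<close> says
  \<open>(x - c) \<bullet> v j \<le> (x - c) \<bullet> v i\<close>.  Hence \<open>F_I - c\<close> is the normal cone of \<open>T\<close>, equivalently of
  \<open>U\<close>, along the face \<open>I\<close>, and the fibre of the projection onto \<open>U\<close> over a point of \<open>G_I\<close> is that
  point plus this cone.  If the sum of \<open>G_I\<close> and the cone lay in a hyperplane with normal \<open>a\<close>, then
  \<open>a\<close> would be constant on the vertices in \<open>I\<close> and orthogonal to the cone; but then the cone contains
  some \<open>y\<close> such that \<open>y + a\<close> also belongs to it, which forces \<open>a = 0\<close>.\<close>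

section \<open>Non-degeneracy, interpolation at the vertices, and the circumcenter\<close>

text \<open>Hyperplanes are level sets of nonzero functionals and contain the simplex as soon as
  they contain its vertices. In this dual form non-degeneracy proves that a vector vanishes.\<close>

lemma nondegenerate_iff_inner:
  fixes v :: "nat \<Rightarrow> 'a::euclidean_space"
  shows "nondegenerate v \<longleftrightarrow> (\<forall>a b. (\<forall>j\<in>{0..DIM('a)}. a \<bullet> v j = b) \<longrightarrow> a = 0)"
proof
  assume nd: "nondegenerate v"
  show "\<forall>a b. (\<forall>j\<in>{0..DIM('a)}. a \<bullet> v j = b) \<longrightarrow> a = 0"
  proof (intro allI impI, rule ccontr)
    fix a :: 'a and b :: real
    assume const: "\<forall>j\<in>{0..DIM('a)}. a \<bullet> v j = b" and "a \<noteq> 0"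
    have "simplex_of v \<subseteq> {x. a \<bullet> x = b}"
      unfolding simplex_of_def
      by (rule hull_minimal) (use const in \<open>auto simp: convex_hyperplane\<close>)
    moreover have "aff_dim {x. a \<bullet> x = b} = int DIM('a) - 1"
      using \<open>a \<noteq> 0\<close> by (simp add: aff_dim_hyperplane of_nat_diff)
    ultimately show False
      using nd affine_hyperplane unfolding nondegenerate_def by blast
  qed
next
  assume R: "\<forall>a b. (\<forall>j\<in>{0..DIM('a)}. a \<bullet> v j = b) \<longrightarrow> a = 0"
  show "nondegenerate v"
    unfolding nondegenerate_def
  proof
    assume "\<exists>H. affine H \<and> aff_dim H = int DIM('a) - 1 \<and> simplex_of v \<subseteq> H"
    then obtain H where "aff_dim H = int DIM('a) - 1" and sub: "simplex_of v \<subseteq> H"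
      by blast
    then obtain a b where "a \<noteq> 0" and H: "H \<subseteq> {x. a \<bullet> x = b}"
      using aff_lowdim_subset_hyperplane[of H] by auto
    have "v j \<in> simplex_of v" if "j \<in> {0..DIM('a)}" for j
      unfolding simplex_of_def using that by (intro hull_inc) auto
    then have "\<forall>j\<in>{0..DIM('a)}. a \<bullet> v j = b"
      using sub H by blast
    then show False
      using R \<open>a \<noteq> 0\<close> by blast
  qed
qed

text \<open>The d edge vectors at \<open>v 0\<close> form a basis, so a linear functional can be
  prescribed on them. The constant \<open>t\<close> accounts for d+1 values facing only d degrees of
  freedom.\<close>

lemma nondegenerate_interpolation:
  fixes v :: "nat \<Rightarrow> 'a::euclidean_space" and f :: "nat \<Rightarrow> real"
  assumes "nondegenerate v"
  obtains y t where "\<And>j. j \<in> {0..DIM('a)} \<Longrightarrow> y \<bullet> v j = f j + t"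
proof -
  define w where "w j = v j - v 0" for j
  define B where "B = w ` {1..DIM('a)}"
  have "span B = UNIV"
  proof (rule ccontr)
    assume "span B \<noteq> UNIV"
    then obtain a where "a \<noteq> 0" and a: "\<forall>x\<in>span B. a \<bullet> x = 0"
      using span_not_UNIV_orthogonal by blast
    have "a \<bullet> v j = a \<bullet> v 0" if "j \<in> {0..DIM('a)}" for j
    proof (cases "j = 0")
      case False
      then have "w j \<in> span B"
        using that by (intro span_base) (auto simp: B_def)
      with a show ?thesis
        by (auto simp: w_def inner_diff_right)
    qed simp
    then show False
      using assms \<open>a \<noteq> 0\<close> unfolding nondegenerate_iff_inner by blast
  qed
  moreover have fin: "finite B" and card: "card B \<le> DIM('a)"
    using card_image_le[of "{1..DIM('a)}" w] by (auto simp: B_def)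
  ultimately have ind: "independent B"
    using card_le_dim_spanning[of B UNIV] by simp
  \<comment> \<open>A spanning set has at least d elements, so the edge vectors are pairwise
    distinct; this makes values indexed by j well defined on \<open>B\<close>.\<close>
  have "DIM('a) \<le> card B"
    using span_card_ge_dim[of B UNIV] \<open>span B = UNIV\<close> fin by simp
  then have inj: "inj_on w {1..DIM('a)}"
    using card by (intro eq_card_imp_inj_on) (auto simp: B_def)
  define f0 where "f0 x = f (the_inv_into {1..DIM('a)} w x) - f 0" for x
  obtain g where "linear g" and g: "\<forall>x\<in>B. g x = f0 x"
    using linear_independent_extend[OF ind] by blast
  \<comment> \<open>The Riesz representative of the functional \<open>g\<close>.\<close>
  define y where "y = adjoint g 1"
  have y: "y \<bullet> x = g x" for x
    using adjoint_works[OF \<open>linear g\<close>, of x 1] by (simp add: y_def inner_commute)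
  have "y \<bullet> v j = f j + (y \<bullet> v 0 - f 0)" if "j \<in> {0..DIM('a)}" for j
  proof (cases "j = 0")
    case False
    then have j: "j \<in> {1..DIM('a)}"
      using that by simp
    then have "y \<bullet> w j = f j - f 0"
      using g the_inv_into_f_f[OF inj j] by (simp add: y B_def f0_def)
    then show ?thesis
      by (simp add: w_def inner_diff_right)
  qed simp
  then show thesis
    by (rule that)
qed

text \<open>Shows that the definite description in \<open>circumcenter\<close> has exactly one
  solution: interpolation supplies a center, and non-degeneracy forces two centers to agree.\<close>

lemma dist_circumcenter:
  fixes v :: "nat \<Rightarrow> 'a::euclidean_space"
  assumes nd: "nondegenerate v" and "i \<in> {0..DIM('a)}" "j \<in> {0..DIM('a)}"
  shows "dist (circumcenter v) (v i) = dist (circumcenter v) (v j)"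
proof -
  let ?P = "\<lambda>c. \<forall>i\<in>{0..DIM('a)}. \<forall>j\<in>{0..DIM('a)}. dist c (v i) = dist c (v j)"
  \<comment> \<open>After squaring, \<open>c \<bullet> c\<close> cancels, so equidistance becomes an
    affine condition on \<open>c\<close>; hence the values \<open>v j \<bullet> v j / 2\<close>
    interpolated below.\<close>
  have expand: "dist c (v i) = dist c (v j) \<longleftrightarrow>
      v i \<bullet> v i - 2 * (c \<bullet> v i) = v j \<bullet> v j - 2 * (c \<bullet> v j)" for c :: 'a and i j
    by (simp add: dist_norm norm_eq inner_diff_left inner_diff_right inner_commute algebra_simps)
  obtain c t where c: "\<And>j. j \<in> {0..DIM('a)} \<Longrightarrow> c \<bullet> v j = v j \<bullet> v j / 2 + t"
    using nondegenerate_interpolation[OF nd, of "\<lambda>j. v j \<bullet> v j / 2"] by blast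
  have "?P c"
  proof (intro ballI)
    fix i j assume "i \<in> {0..DIM('a)}" "j \<in> {0..DIM('a)}"
    then show "dist c (v i) = dist c (v j)"
      unfolding expand using c[of i] c[of j] by simp
  qed
  moreover have "c' = c" if "?P c'" for c'
  proof -
    have "\<forall>j\<in>{0..DIM('a)}. (c' - c) \<bullet> v j = (c' - c) \<bullet> v 0"
    proof
      fix j assume j: "j \<in> {0..DIM('a)}"
      have "v j \<bullet> v j - 2 * (x \<bullet> v j) = v 0 \<bullet> v 0 - 2 * (x \<bullet> v 0)" if "?P x" for x
      proof -
        have "0 \<in> {0..DIM('a)}"
          by simp
        with that j have "dist x (v j) = dist x (v 0)"
          by blast
        then show ?thesis
          unfolding expand .
      qed
      from this[OF \<open>?P c\<close>] this[OF \<open>?P c'\<close>] show "(c' - c) \<bullet> v j = (c' - c) \<bullet> v 0"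
        by (simp add: inner_diff_left)
    qed
    then have "c' - c = 0"
      using nd unfolding nondegenerate_iff_inner by blast
    then show ?thesis
      by simp
  qed
  ultimately have "?P (circumcenter v)"
    unfolding circumcenter_def by (rule theI)
  then show ?thesis
    using assms by blast
qed

section \<open>Normal cones and Voronoi faces\<close>

text \<open>The outer normal cone, tested on vertices only, since a linear functional attains its
  maximum over a simplex at a vertex. Only differences of the values \<open>y \<bullet> v j\<close>
  matter, so translating or positively scaling the simplex preserves it.\<close>

definition normal_cone :: "(nat \<Rightarrow> 'a::euclidean_space) \<Rightarrow> nat set \<Rightarrow> 'a set" where
  "normal_cone v I = {y. \<forall>i\<in>I. \<forall>j\<in>{0..DIM('a)}. y \<bullet> v j \<le> y \<bullet> v i}"

lemma convex_normal_cone: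
  fixes v :: "nat \<Rightarrow> 'a::euclidean_space"
  shows "convex (normal_cone v I)"
proof (rule convexI)
  fix x y and s t :: real
  assume xy: "x \<in> normal_cone v I" "y \<in> normal_cone v I" and st: "0 \<le> s" "0 \<le> t"
  show "s *\<^sub>R x + t *\<^sub>R y \<in> normal_cone v I"
    unfolding normal_cone_def mem_Collect_eq
  proof (intro ballI)
    fix i j assume "i \<in> I" "j \<in> {0..DIM('a)}"
    then have "x \<bullet> v j \<le> x \<bullet> v i" "y \<bullet> v j \<le> y \<bullet> v i"
      using xy unfolding normal_cone_def by blast+
    then show "(s *\<^sub>R x + t *\<^sub>R y) \<bullet> v j \<le> (s *\<^sub>R x + t *\<^sub>R y) \<bullet> v i"
      using st by (simp add: inner_add_left add_mono mult_left_mono)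
  qed
qed

lemma normal_cone_half_vertex: "normal_cone (half_vertex v) I = normal_cone v I"
  by (auto simp: normal_cone_def half_vertex_def inner_add_right)

lemma scaleR_normal_cone_iff:
  assumes "r > 0"
  shows "r *\<^sub>R y \<in> normal_cone v I \<longleftrightarrow> y \<in> normal_cone v I"
  using assms by (simp add: normal_cone_def)

lemma voronoi_face_iff_normal_cone:
  fixes v :: "nat \<Rightarrow> 'a::euclidean_space"
  assumes nd: "nondegenerate v" and I: "I \<subseteq> {0..DIM('a)}"
  shows "x \<in> voronoi_face v I \<longleftrightarrow> x - circumcenter v \<in> normal_cone v I"
proof -
  let ?c = "circumcenter v"
  \<comment> \<open>In |x - v i|^2 = |x - c|^2 - 2 (x - c) \<bullet> (v i - c) + |v i - c|^2 only
    the middle term depends on i.\<close>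
  have key: "norm (x - v i) \<le> norm (x - v j) \<longleftrightarrow> (x - ?c) \<bullet> v j \<le> (x - ?c) \<bullet> v i"
    if "i \<in> {0..DIM('a)}" "j \<in> {0..DIM('a)}" for i j
    using dist_circumcenter[OF nd that]
    by (auto simp: dist_norm norm_eq norm_le inner_diff_left inner_diff_right inner_commute
        algebra_simps)
  \<comment> \<open>The case j = i, excluded in \<open>voronoi_cell\<close>, holds
    trivially.\<close>
  have "x \<in> voronoi_face v I \<longleftrightarrow> (\<forall>i\<in>I. \<forall>j\<in>{0..DIM('a)}. norm (x - v i) \<le> norm (x - v j))"
    unfolding voronoi_face_def voronoi_cell_def by blast
  also have "\<dots> \<longleftrightarrow> x - ?c \<in> normal_cone v I"
    unfolding normal_cone_def mem_Collect_eq using I by (intro ball_cong refl key) auto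
  finally show ?thesis .
qed

text \<open>The factor 1/2 is absorbed because a cone is invariant under positive scaling.\<close>

lemma scale_shift_voronoi_face:
  fixes v :: "nat \<Rightarrow> 'a::euclidean_space"
  assumes "nondegenerate v" "I \<subseteq> {0..DIM('a)}"
  shows "scale_set (1/2) (shift_set (voronoi_face v I) (circumcenter v)) = normal_cone v I"
proof (intro set_eqI iffI)
  fix y assume "y \<in> scale_set (1/2) (shift_set (voronoi_face v I) (circumcenter v))"
  then obtain x where "x \<in> voronoi_face v I" "y = (1/2) *\<^sub>R (x - circumcenter v)"
    by (auto simp: scale_set_def shift_set_def)
  then show "y \<in> normal_cone v I"
    using voronoi_face_iff_normal_cone[OF assms]
      scaleR_normal_cone_iff[of "1/2" "x - circumcenter v" v I] by simp
next
  fix y assume y: "y \<in> normal_cone v I"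
  define x where "x = circumcenter v + 2 *\<^sub>R y"
  have "x \<in> voronoi_face v I"
    using y voronoi_face_iff_normal_cone[OF assms] by (simp add: x_def scaleR_normal_cone_iff)
  moreover have "y = (1/2) *\<^sub>R (x - circumcenter v)"
    by (simp add: x_def)
  ultimately show "y \<in> scale_set (1/2) (shift_set (voronoi_face v I) (circumcenter v))"
    unfolding scale_set_def shift_set_def by blast
qed

section \<open>Barycentric coordinates and open faces\<close>

text \<open>Uniqueness of barycentric coordinates, which makes the definite description in
  \<open>bary\<close> meaningful.\<close>

lemma bary_sum:
  fixes v :: "nat \<Rightarrow> 'a::euclidean_space"
  assumes nd: "nondegenerate v"
    and b0: "\<forall>i. i \<notin> {0..DIM('a)} \<longrightarrow> b i = 0" and b1: "(\<Sum>i\<in>{0..DIM('a)}. b i) = 1"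
  shows "bary v (\<Sum>i\<in>{0..DIM('a)}. b i *\<^sub>R v i) = b"
  unfolding bary_def
proof (rule the_equality)
  show "(\<forall>i. i \<notin> {0..DIM('a)} \<longrightarrow> b i = 0) \<and> (\<Sum>i\<in>{0..DIM('a)}. b i) = 1 \<and>
      (\<Sum>i\<in>{0..DIM('a)}. b i *\<^sub>R v i) = (\<Sum>i\<in>{0..DIM('a)}. b i *\<^sub>R v i)"
    using b0 b1 by blast
next
  fix b' :: "nat \<Rightarrow> real"
  assume b': "(\<forall>i. i \<notin> {0..DIM('a)} \<longrightarrow> b' i = 0) \<and> (\<Sum>i\<in>{0..DIM('a)}. b' i) = 1 \<and>
      (\<Sum>i\<in>{0..DIM('a)}. b i *\<^sub>R v i) = (\<Sum>i\<in>{0..DIM('a)}. b' i *\<^sub>R v i)"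
  show "b' = b"
  proof
    fix k
    show "b' k = b k"
    proof (cases "k \<in> {0..DIM('a)}")
      case True
      \<comment> \<open>Up to the common shift \<open>t\<close>, \<open>y\<close> is 1 at
        \<open>v k\<close> and 0 at the other vertices, so pairing with it reads off the k-th
        coefficient.\<close>
      obtain y t where y: "\<And>j. j \<in> {0..DIM('a)} \<Longrightarrow> y \<bullet> v j = (if j = k then 1 else 0) + t"
        using nondegenerate_interpolation[OF nd, of "\<lambda>j. if j = k then 1 else 0"] by blast
      have read_off: "y \<bullet> (\<Sum>i\<in>{0..DIM('a)}. e i *\<^sub>R v i) = e k + t"
        if "(\<Sum>i\<in>{0..DIM('a)}. e i) = 1" for e
      proof -
        have "y \<bullet> (\<Sum>i\<in>{0..DIM('a)}. e i *\<^sub>R v i) =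
            (\<Sum>i\<in>{0..DIM('a)}. (if i = k then e i else 0) + e i * t)"
          unfolding inner_sum_right by (rule sum.cong) (auto simp: y algebra_simps)
        also have "\<dots> = e k + t"
          using True that by (simp add: sum.distrib flip: sum_distrib_right)
        finally show ?thesis .
      qed
      show ?thesis
        using read_off[OF b1] read_off[of b'] b' by simp
    next
      case False
      then show ?thesis
        using b0 b' by simp
    qed
  qed
qed

text \<open>Replaces \<open>bary\<close> by explicit positive weights on \<open>I\<close>; later
  arguments about faces work with these weights.\<close>

lemma open_face_eq:
  fixes v :: "nat \<Rightarrow> 'a::euclidean_space"
  assumes nd: "nondegenerate v" and I: "I \<subseteq> {0..DIM('a)}"
  shows "open_face v I = {\<Sum>i\<in>I. b i *\<^sub>R v i | b. (\<forall>i\<in>I. b i > 0) \<and> sum b I = 1}"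
    (is "_ = ?R")
proof (intro set_eqI iffI)
  fix x assume x: "x \<in> open_face v I"
  \<comment> \<open>A union of singletons indexed by i yields coefficients attached to indices
    rather than to points.\<close>
  then have "x \<in> convex hull (\<Union>i\<in>{0..DIM('a)}. {v i})"
    by (simp add: open_face_def simplex_of_def UNION_singleton_eq_range)
  then obtain e where e1: "sum e {0..DIM('a)} = 1" and ex: "(\<Sum>i\<in>{0..DIM('a)}. e i *\<^sub>R v i) = x"
    by (subst (asm) convex_hull_finite_union) auto
  \<comment> \<open>\<open>e\<close> is arbitrary beyond d, whereas \<open>bary\<close> vanishes
    there.\<close>
  define b where "b i = (if i \<in> {0..DIM('a)} then e i else 0)" for i
  have b1: "sum b {0..DIM('a)} = 1" and bx: "(\<Sum>i\<in>{0..DIM('a)}. b i *\<^sub>R v i) = x"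
    using e1 ex by (simp_all add: b_def)
  have "bary v x = b"
    unfolding bx[symmetric] by (rule bary_sum[OF nd _ b1]) (simp add: b_def)
  then have pos: "\<forall>i\<in>I. b i > 0" and zero: "\<forall>i\<in>{0..DIM('a)} - I. b i = 0"
    using x by (auto simp: open_face_def)
  have "sum b I = 1" "(\<Sum>i\<in>I. b i *\<^sub>R v i) = x"
    unfolding b1[symmetric] bx[symmetric] using I zero
    by (auto intro!: sum.mono_neutral_left)
  with pos show "x \<in> ?R"
    by blast
next
  fix x assume "x \<in> ?R"
  then obtain e where pos: "\<forall>i\<in>I. e i > 0" and e1: "sum e I = 1" and x: "x = (\<Sum>i\<in>I. e i *\<^sub>R v i)"
    by blast
  define b where "b i = (if i \<in> I then e i else 0)" for i
  have b1: "sum b {0..DIM('a)} = 1" and bx: "x = (\<Sum>i\<in>{0..DIM('a)}. b i *\<^sub>R v i)"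
    unfolding e1[symmetric] x
    by (rule sum.mono_neutral_cong_right sum.mono_neutral_cong_left; use I in \<open>auto simp: b_def\<close>)+
  have "bary v x = b"
    unfolding bx by (rule bary_sum[OF nd _ b1]) (use I in \<open>auto simp: b_def\<close>)
  moreover have "x \<in> simplex_of v"
    unfolding bx simplex_of_def
    using b1 pos by (intro convex_sum) (auto simp: b_def less_imp_le intro: hull_inc)
  ultimately show "x \<in> open_face v I"
    using pos by (auto simp: open_face_def b_def)
qed

lemma sum_in_open_face:
  fixes v :: "nat \<Rightarrow> 'a::euclidean_space"
  assumes "nondegenerate v" "I \<subseteq> {0..DIM('a)}" "\<And>i. i \<in> I \<Longrightarrow> b i > 0" "sum b I = 1"
  shows "(\<Sum>i\<in>I. b i *\<^sub>R v i) \<in> open_face v I"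
  unfolding open_face_eq[OF assms(1,2)] using assms(3,4) by (intro CollectI exI[of _ b]) auto

lemma open_face_nonempty:
  fixes v :: "nat \<Rightarrow> 'a::euclidean_space"
  assumes "nondegenerate v" "I \<noteq> {}" "I \<subseteq> {0..DIM('a)}"
  shows "open_face v I \<noteq> {}"
proof -
  have "finite I"
    using assms(3) finite_subset by blast
  then have "(\<Sum>i\<in>I. (1 / card I) *\<^sub>R v i) \<in> open_face v I"
    using assms by (intro sum_in_open_face) (auto simp: card_gt_0_iff)
  then show ?thesis
    by blast
qed

lemma convex_open_face:
  fixes v :: "nat \<Rightarrow> 'a::euclidean_space"
  assumes nd: "nondegenerate v" and I: "I \<subseteq> {0..DIM('a)}"
  shows "convex (open_face v I)"
proof (rule convexI)
  fix x y s t
  assume x: "x \<in> open_face v I" and y: "y \<in> open_face v I"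
    and st: "0 \<le> s" "0 \<le> t" "s + t = (1::real)"
  obtain b b' where b: "\<forall>i\<in>I. b i > 0" "sum b I = 1" "x = (\<Sum>i\<in>I. b i *\<^sub>R v i)"
    and b': "\<forall>i\<in>I. b' i > 0" "sum b' I = 1" "y = (\<Sum>i\<in>I. b' i *\<^sub>R v i)"
    using x y unfolding open_face_eq[OF nd I] by blast
  let ?e = "\<lambda>i. s * b i + t * b' i"
  \<comment> \<open>The strict convex bound, applied to negated coefficients, also covers s = 0 and
    t = 0.\<close>
  have "?e i > 0" if "i \<in> I" for i
    using convex_bound_lt[of "- b i" 0 "- b' i" s t] st b b' that by simp
  moreover have "sum ?e I = 1"
    using b b' st by (simp add: sum.distrib flip: sum_distrib_left)
  moreover have "s *\<^sub>R x + t *\<^sub>R y = (\<Sum>i\<in>I. ?e i *\<^sub>R v i)"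
    using b b' by (simp add: scaleR_sum_right scaleR_add_left sum.distrib)
  ultimately show "s *\<^sub>R x + t *\<^sub>R y \<in> open_face v I"
    using sum_in_open_face[OF nd I, of ?e] by simp
qed

section \<open>Orthogonality of faces and normal cones\<close>

text \<open>All vertices indexed by \<open>I\<close> maximize \<open>y\<close>, hence share one
  value, and averaging preserves it.\<close>

lemma normal_cone_inner_open_face:
  fixes v :: "nat \<Rightarrow> 'a::euclidean_space"
  assumes nd: "nondegenerate v" and I: "I \<subseteq> {0..DIM('a)}"
    and y: "y \<in> normal_cone v I" and p: "p \<in> open_face v I" and i: "i \<in> I"
  shows "y \<bullet> p = y \<bullet> v i"
proof -
  obtain b where b: "sum b I = 1" and pb: "p = (\<Sum>k\<in>I. b k *\<^sub>R v k)"
    using p unfolding open_face_eq[OF nd I] by blast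
  have eq: "y \<bullet> v k = y \<bullet> v i" if "k \<in> I" for k
  proof (rule antisym)
    show "y \<bullet> v k \<le> y \<bullet> v i" "y \<bullet> v i \<le> y \<bullet> v k"
      using y that i I unfolding normal_cone_def by blast+
  qed
  have "y \<bullet> p = (\<Sum>k\<in>I. b k * (y \<bullet> v i))"
    unfolding pb inner_sum_right by (rule sum.cong) (auto simp: eq)
  then show ?thesis
    using b by (simp flip: sum_distrib_right)
qed

lemma mutually_orthogonal_open_face_normal_cone:
  fixes v :: "nat \<Rightarrow> 'a::euclidean_space"
  assumes nd: "nondegenerate v" and "I \<noteq> {}" and I: "I \<subseteq> {0..DIM('a)}"
  shows "mutually_orthogonal (open_face v I) (normal_cone v I)"
proof -
  have "0 \<in> normal_cone v I"
    by (simp add: normal_cone_def)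
  moreover have "(a1 - a2) \<bullet> (b1 - b2) = 0"
    if "a1 \<in> open_face v I" "a2 \<in> open_face v I" "b1 \<in> normal_cone v I" "b2 \<in> normal_cone v I"
    for a1 a2 b1 b2
  proof -
    obtain i where "i \<in> I"
      using assms by blast
    note eq = normal_cone_inner_open_face[OF nd I _ _ this]
    show ?thesis
      using eq[OF that(3,1)] eq[OF that(3,2)] eq[OF that(4,1)] eq[OF that(4,2)]
      by (simp add: inner_diff_left inner_diff_right inner_commute)
  qed
  ultimately show ?thesis
    unfolding mutually_orthogonal_def using open_face_nonempty[OF assms] by blast
qed

lemma mutually_orthogonal_translate:
  assumes "mutually_orthogonal A B"
  shows "mutually_orthogonal A ((+) c ` B)"
  using assms unfolding mutually_orthogonal_def by simp

lemma voronoi_face_eq_translate: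
  fixes v :: "nat \<Rightarrow> 'a::euclidean_space"
  assumes "nondegenerate v" "I \<subseteq> {0..DIM('a)}"
  shows "voronoi_face v I = (+) (circumcenter v) ` normal_cone v I"
  using voronoi_face_iff_normal_cone[OF assms] by (force simp: image_iff algebra_simps)

section \<open>Passage from T to U\<close>

text \<open>Makes the results on general non-degenerate simplices available for U.\<close>

lemma nondegenerate_half_vertex:
  fixes v :: "nat \<Rightarrow> 'a::euclidean_space"
  assumes "nondegenerate v"
  shows "nondegenerate (half_vertex v)"
  unfolding nondegenerate_iff_inner
proof (intro allI impI)
  fix a :: 'a and b
  assume "\<forall>j\<in>{0..DIM('a)}. a \<bullet> half_vertex v j = b"
  then have "\<forall>j\<in>{0..DIM('a)}. a \<bullet> v j = 2 * b - a \<bullet> circumcenter v"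
    by (force simp: half_vertex_def inner_add_right field_simps)
  then show "a = 0"
    using assms unfolding nondegenerate_iff_inner by blast
qed

text \<open>The map from T to U is affine, so it commutes with combinations whose weights sum to
  1.\<close>

lemma open_face_half_vertex:
  fixes v :: "nat \<Rightarrow> 'a::euclidean_space"
  assumes nd: "nondegenerate v" and I: "I \<subseteq> {0..DIM('a)}"
  shows "open_face (half_vertex v) I = (\<lambda>x. (1/2) *\<^sub>R (circumcenter v + x)) ` open_face v I"
proof -
  have "(\<Sum>i\<in>I. b i *\<^sub>R half_vertex v i) =
      (1/2) *\<^sub>R (circumcenter v + (\<Sum>i\<in>I. b i *\<^sub>R v i))" if "sum b I = 1" for b
  proof -
    have "(\<Sum>i\<in>I. b i *\<^sub>R half_vertex v i) =
        (1/2) *\<^sub>R (sum b I *\<^sub>R circumcenter v + (\<Sum>i\<in>I. b i *\<^sub>R v i))"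
      by (simp add: half_vertex_def scaleR_sum_right scaleR_sum_left scaleR_add_right sum.distrib)
    then show ?thesis
      using that by simp
  qed
  then show ?thesis
    unfolding open_face_eq[OF nd I] open_face_eq[OF nondegenerate_half_vertex[OF nd] I]
    by (force simp: image_iff)
qed

section \<open>The projection onto a simplex and its fibres\<close>

text \<open>The sufficiency half of the obtuse angle criterion; \<open>closest_point_dot\<close> is
  the other half.\<close>

lemma closest_point_eqI_inner:
  fixes S :: "'a::euclidean_space set"
  assumes "convex S" "closed S" "p \<in> S" and obtuse: "\<And>z. z \<in> S \<Longrightarrow> (x - p) \<bullet> (z - p) \<le> 0"
  shows "closest_point S x = p"
proof -
  have "dist x p \<le> dist x z" if "z \<in> S" for z
  proof -
    have "(x - z) \<bullet> (x - z) = (x - p) \<bullet> (x - p) - 2 * ((x - p) \<bullet> (z - p)) + (z - p) \<bullet> (z - p)"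
      by (simp add: inner_diff_left inner_diff_right inner_commute)
    then show ?thesis
      using obtuse[OF that] inner_ge_zero[of "z - p"] unfolding dist_norm norm_le by linarith
  qed
  then show ?thesis
    using closest_point_unique assms by metis
qed

text \<open>A point p is nearest to x iff x - p attains its maximum over the simplex at p. Since p
  has positive weight on every vertex indexed by \<open>I\<close>, all of these are then
  maximizers.\<close>

lemma closest_point_vimage_open_face:
  fixes v :: "nat \<Rightarrow> 'a::euclidean_space"
  assumes nd: "nondegenerate v" and "I \<noteq> {}" and I: "I \<subseteq> {0..DIM('a)}"
  shows "closest_point (simplex_of v) -` open_face v I = orth_sum (open_face v I) (normal_cone v I)"
proof -
  let ?S = "simplex_of v"
  have S: "convex ?S" "closed ?S"
    unfolding simplex_of_def
    by (auto intro: compact_imp_closed finite_imp_compact_convex_hull)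
  have v: "v j \<in> ?S" if "j \<in> {0..DIM('a)}" for j
    unfolding simplex_of_def using that by (intro hull_inc) auto
  show ?thesis
  proof (intro set_eqI iffI)
    fix x assume "x \<in> closest_point ?S -` open_face v I"
    moreover define p where "p = closest_point ?S x"
    ultimately have p: "p \<in> open_face v I"
      by simp
    define y where "y = x - p"
    have le: "y \<bullet> v j \<le> y \<bullet> p" if "j \<in> {0..DIM('a)}" for j
      using closest_point_dot[OF S v[OF that], of x] by (simp add: p_def y_def inner_diff_right)
    obtain b where pos: "\<forall>i\<in>I. b i > 0" and b1: "sum b I = 1" and pb: "p = (\<Sum>i\<in>I. b i *\<^sub>R v i)"
      using p unfolding open_face_eq[OF nd I] by blast
    \<comment> \<open>The nonpositive numbers \<open>y \<bullet> (v i - p)\<close> have a vanishing average with positive weights.\<close>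
    have "(\<Sum>i\<in>I. b i * (y \<bullet> p - y \<bullet> v i)) = sum b I * (y \<bullet> p) - y \<bullet> p"
      by (simp add: pb inner_sum_right sum_subtractf right_diff_distrib sum_distrib_right)
    then have "(\<Sum>i\<in>I. b i * (y \<bullet> p - y \<bullet> v i)) = 0"
      using b1 by simp
    moreover have "finite I"
      using I finite_subset by blast
    ultimately have "\<forall>i\<in>I. b i * (y \<bullet> p - y \<bullet> v i) = 0"
      using le pos I by (subst (asm) sum_nonneg_eq_0_iff) (force intro!: mult_nonneg_nonneg)+
    then have "\<forall>i\<in>I. y \<bullet> v i = y \<bullet> p"
      using pos by force
    then have "y \<in> normal_cone v I"
      using le by (auto simp: normal_cone_def)
    moreover have "x = p + y"
      by (simp add: y_def)
    ultimately show "x \<in> orth_sum (open_face v I) (normal_cone v I)"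
      using p unfolding orth_sum_def by blast
  next
    fix x assume "x \<in> orth_sum (open_face v I) (normal_cone v I)"
    then obtain p y where x: "x = p + y" and p: "p \<in> open_face v I" and y: "y \<in> normal_cone v I"
      by (auto simp: orth_sum_def)
    obtain i where i: "i \<in> I"
      using assms by blast
    \<comment> \<open>The value at \<open>p\<close> equals that at \<open>v i\<close>, which is
      maximal among the vertices; the half-space is convex and so contains the hull.\<close>
    have "?S \<subseteq> {z. y \<bullet> z \<le> y \<bullet> p}"
      unfolding simplex_of_def normal_cone_inner_open_face[OF nd I y p i]
      by (rule hull_minimal) (use y i in \<open>auto simp: normal_cone_def convex_halfspace_le\<close>)
    then have "closest_point ?S x = p"
      using p by (intro closest_point_eqI_inner S) (auto simp: open_face_def x inner_diff_right)
    with p show "x \<in> closest_point ?S -` open_face v I"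
      by simp
  qed
qed

section \<open>Non-empty interior\<close>

text \<open>A vertex need not lie in the open face, so vertices are compared through points of the
  face that favour one of them.\<close>

lemma open_face_inner_const_imp_vertices:
  fixes v :: "nat \<Rightarrow> 'a::euclidean_space"
  assumes nd: "nondegenerate v" and I: "I \<subseteq> {0..DIM('a)}"
    and const: "\<And>p. p \<in> open_face v I \<Longrightarrow> a \<bullet> p = \<beta>" and k: "k \<in> I" and l: "l \<in> I"
  shows "a \<bullet> v k = a \<bullet> v l"
proof -
  have fin: "finite I"
    using I finite_subset by blast
  let ?m = "real (card I) + 1"
  have val: "(\<Sum>i\<in>I. a \<bullet> v i) + a \<bullet> v k = ?m * \<beta>" if k: "k \<in> I" for k
  proof -
    \<comment> \<open>Equal weights except for a doubled one at k, hence the normalization by card I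
      + 1.\<close>
    let ?b = "\<lambda>i. (1 + (if i = k then 1 else 0)) / ?m"
    have "sum ?b I = 1"
      using fin k by (simp add: sum.distrib flip: sum_divide_distrib)
    then have "(\<Sum>i\<in>I. ?b i *\<^sub>R v i) \<in> open_face v I"
      by (intro sum_in_open_face nd I) (auto intro!: divide_pos_pos)
    then have "\<beta> = a \<bullet> (\<Sum>i\<in>I. ?b i *\<^sub>R v i)"
      using const by simp
    also have "\<dots> = (\<Sum>i\<in>I. (a \<bullet> v i + (if i = k then a \<bullet> v i else 0)) / ?m)"
      unfolding inner_sum_right by (intro sum.cong) auto
    also have "\<dots> = ((\<Sum>i\<in>I. a \<bullet> v i) + a \<bullet> v k) / ?m"
      using fin k by (simp add: sum.distrib flip: sum_divide_distrib)
    finally show ?thesis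
      by (simp add: field_simps)
  qed
  show ?thesis
    using val[OF k] val[OF l] by simp
qed

lemma convex_orth_sum:
  assumes "convex A" "convex B"
  shows "convex (orth_sum A B)"
proof -
  have "orth_sum A B = (\<Union>x\<in>A. \<Union>y\<in>B. {x + y})"
    by (auto simp: orth_sum_def)
  then show ?thesis
    using convex_sums[OF assms] by simp
qed

lemma interior_orth_sum_open_face_normal_cone:
  fixes v :: "nat \<Rightarrow> 'a::euclidean_space"
  assumes nd: "nondegenerate v" and "I \<noteq> {}" and I: "I \<subseteq> {0..DIM('a)}"
  shows "interior (orth_sum (open_face v I) (normal_cone v I)) \<noteq> {}"
proof
  assume "interior (orth_sum (open_face v I) (normal_cone v I)) = {}"
  moreover have "convex (orth_sum (open_face v I) (normal_cone v I))"
    using convex_orth_sum convex_open_face[OF nd I] convex_normal_cone by blast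
  ultimately obtain a \<beta> where "a \<noteq> 0"
    and "orth_sum (open_face v I) (normal_cone v I) \<subseteq> {x. a \<bullet> x = \<beta>}"
    using empty_interior_subset_hyperplane by metis
  then have sum: "a \<bullet> p + a \<bullet> y = \<beta>" if "p \<in> open_face v I" "y \<in> normal_cone v I" for p y
    using that by (force simp: orth_sum_def simp flip: inner_add_right)
  \<comment> \<open>Taking 0 from the cone makes \<open>a\<close> constant on the face; subtracting
    this constant makes \<open>a\<close> vanish on the cone.\<close>
  have "0 \<in> normal_cone v I"
    by (simp add: normal_cone_def)
  then have p: "a \<bullet> p = \<beta>" if "p \<in> open_face v I" for p
    using sum[OF that] by force
  have y0: "a \<bullet> y = 0" if "y \<in> normal_cone v I" for y
    using sum[OF _ that] p open_face_nonempty[OF assms] by fastforce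
  obtain i0 where i0: "i0 \<in> I"
    using assms by blast
  have a_I: "a \<bullet> v i = a \<bullet> v i0" if "i \<in> I" for i
    using open_face_inner_const_imp_vertices[OF nd I p that i0] .
  \<comment> \<open>The prescribed values are 0 on \<open>I\<close> and nowhere positive. The
    absolute value still dominates after \<open>a\<close> is added, so both \<open>y\<close> and
    \<open>y + a\<close> are maximal on \<open>I\<close>.\<close>
  obtain y t where y: "\<And>j. j \<in> {0..DIM('a)} \<Longrightarrow> y \<bullet> v j = - \<bar>a \<bullet> v j - a \<bullet> v i0\<bar> + t"
    using nondegenerate_interpolation[OF nd, of "\<lambda>j. - \<bar>a \<bullet> v j - a \<bullet> v i0\<bar>"] by blast
  have yI: "y \<bullet> v i = t" if "i \<in> I" for i
    using y[of i] a_I[OF that] that I by auto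
  have "y \<in> normal_cone v I"
    by (auto simp: normal_cone_def yI y)
  moreover have "y + a \<in> normal_cone v I"
    unfolding normal_cone_def
  proof (intro CollectI ballI)
    fix i j assume "i \<in> I" "j \<in> {0..DIM('a)}"
    then show "(y + a) \<bullet> v j \<le> (y + a) \<bullet> v i"
      using y[of j] yI[of i] a_I[of i] by (simp add: inner_add_left)
  qed
  ultimately have "a \<bullet> a = 0"
    using y0[of y] y0[of "y + a"] by (simp add: inner_add_right)
  with \<open>a \<noteq> 0\<close> show False
    by simp
qed

section \<open>Application to U and combination of the results\<close>

theorem proposition5p1:
  fixes v :: "nat \<Rightarrow> 'a::euclidean_space" and I :: "nat set"
  assumes "nondegenerate v"
    and "I \<noteq> {}" and "I \<subseteq> {0..DIM('a)}"
  shows "mutually_orthogonal (open_face (half_vertex v) I) (voronoi_face v I)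
    \<and> convex (nearest_point v -` open_face (half_vertex v) I)
    \<and> interior (nearest_point v -` open_face (half_vertex v) I) \<noteq> {}
    \<and> mutually_orthogonal (open_face (half_vertex v) I)
        (scale_set (1/2) (shift_set (voronoi_face v I) (circumcenter v)))
    \<and> nearest_point v -` open_face (half_vertex v) I =
        orth_sum (open_face (half_vertex v) I)
          (scale_set (1/2) (shift_set (voronoi_face v I) (circumcenter v)))
    \<and> mutually_orthogonal (open_face v I) (voronoi_face v I)
    \<and> nearest_point v -` open_face (half_vertex v) I =
        scale_set (1/2) (orth_sum (open_face v I) (voronoi_face v I))"
proof -
  let ?G = "open_face (half_vertex v) I" and ?N = "normal_cone v I" and ?c = "circumcenter v"
  let ?D = "open_face v I" and ?F = "voronoi_face v I"
  note nd = assms(1) and I = assms(3)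
  note ndh = nondegenerate_half_vertex[OF nd]
  have N: "scale_set (1/2) (shift_set ?F ?c) = ?N"
    by (rule scale_shift_voronoi_face[OF nd I])
  \<comment> \<open>The projection is onto U, but U and T have the same normal cones.\<close>
  have fibre: "nearest_point v -` ?G = orth_sum ?G ?N"
    using closest_point_vimage_open_face[OF ndh assms(2,3)]
    by (simp add: nearest_point_def normal_cone_half_vertex)
  have "convex (orth_sum ?G ?N)"
    using convex_orth_sum convex_open_face[OF ndh I] convex_normal_cone by blast
  moreover have "interior (orth_sum ?G ?N) \<noteq> {}"
    using interior_orth_sum_open_face_normal_cone[OF ndh assms(2,3)]
    by (simp add: normal_cone_half_vertex)
  moreover have GN: "mutually_orthogonal ?G ?N"
    using mutually_orthogonal_open_face_normal_cone[OF ndh assms(2,3)]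
    by (simp add: normal_cone_half_vertex)
  \<comment> \<open>\<open>?F\<close> is the cone translated by \<open>?c\<close>, and orthogonality
    only sees differences.\<close>
  moreover have "mutually_orthogonal ?G ?F" "mutually_orthogonal ?D ?F"
    using GN mutually_orthogonal_open_face_normal_cone[OF assms]
    by (simp_all add: voronoi_face_eq_translate[OF nd I] mutually_orthogonal_translate)
  moreover have "orth_sum ?G ?N = scale_set (1/2) (orth_sum ?D ?F)"
  proof -
    \<comment> \<open>Points of both factors are written through T and \<open>?F\<close>, so that
      the circumcenter cancels: (c + d)/2 + (f - c)/2 = (d + f)/2.\<close>
    have "orth_sum ?G ?N =
        {(1/2) *\<^sub>R (?c + d) + (1/2) *\<^sub>R (f - ?c) | d f. d \<in> ?D \<and> f \<in> ?F}"
      unfolding N[symmetric] open_face_half_vertex[OF nd I] orth_sum_def scale_set_def shift_set_def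
      by blast
    also have "\<dots> = {(1/2) *\<^sub>R (d + f) | d f. d \<in> ?D \<and> f \<in> ?F}"
      by (simp add: algebra_simps)
    also have "\<dots> = scale_set (1/2) (orth_sum ?D ?F)"
      unfolding orth_sum_def scale_set_def by blast
    finally show ?thesis .
  qed
  ultimately show ?thesis
    unfolding N fibre by blast
qed

end
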